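(* Let $\Gamma=(V,H)$ be an oriented hypergraph with no vertex of degree zero, and let $\lambda_1$ and $\lambda_n$ be the smallest and largest eigenvalues of its normalized Laplacian. Then for every nonempty $S\subseteq V$ with $\chi(S)\ge 2$, $$\lambda_n\ge 1+\Big(1-\frac{\tilde e(S)}{\mathrm{vol}(S)}\Big)\frac{1}{\chi(S)-1}\ge\lambda_1.$$ In particular, if $\chi:=\chi(\Gamma)\ge 2$, then $$\lambda_n\ge\frac{\chi}{\chi-1}-\frac{\tilde e(V)}{\mathrm{vol}(V)}\cdot\frac{1}{\chi-1}\ge\lambda_1\qquad\text{and}\qquad \lambda_n\ge\frac{\chi-\tilde h'}{\chi-1},$$ where $\tilde h':=\min_{\emptyset\neq S\subseteq V}\frac{\tilde e(S)}{\mathrm{vol}(S)}$.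
   Context: An oriented hypergraph is a pair $\Gamma=(V,H)$, $V$ finite, each hyperedge $h\in H$ a pair $(h_{in},h_{out})$ of disjoint subsets of $V$; $h$ is identified with $h_{in}\cup h_{out}$. $\deg(i)$ is the number of hyperedges containing $i$. The normalized Laplacian acts on $f:V\to\mathbb{R}$ by $$Lf(i)=\frac{1}{\deg(i)}\Big[\sum_{h:\,i\in h_{in}}\Big(\sum_{i'\in h_{in}}f(i')-\sum_{j'\in h_{out}}f(j')\Big)-\sum_{h:\,i\in h_{out}}\Big(\sum_{i'\in h_{in}}f(i')-\sum_{j'\in h_{out}}f(j')\Big)\Big],$$ with real eigenvalues $\lambda_1\le\dots\le\lambda_n$. A proper $k$-coloring of an oriented hypergraph is a map $c:V\to\{1,\dots,k\}$ with $c(i)\ne c(j)$ whenever $i\neq j$ lie in a common hyperedge; the vertex coloring number $\chi$ is the least such $k$. For nonempty $S\subseteq V$, $\chi(S)$ is the coloring number of the restricted sub-hypergraph $(S,\{(h_{in}\cap S,h_{out}\cap S):h\in H\})$, and $\chi(\Gamma)=\chi(V)$. Also $\mathrm{vol}(S)=\sum_{i\in S}\deg(i)$ and $\tilde e(S)=\sum_{h\in H}\big(\#(h_{in}\cap S)-\#(h_{out}\cap S)\big)^2$. *)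

theory Defs
  imports Complex_Main
begin

definition oriented_hypergraph :: "'a set \<Rightarrow> ('a set \<times> 'a set) set \<Rightarrow> bool" where
  "oriented_hypergraph V H \<longleftrightarrow>
     finite V \<and> (\<forall>(A, B)\<in>H. A \<subseteq> V \<and> B \<subseteq> V \<and> A \<inter> B = {})"

definition verts_of :: "'a set \<times> 'a set \<Rightarrow> 'a set" where
  "verts_of h = fst h \<union> snd h"

definition hdeg :: "('a set \<times> 'a set) set \<Rightarrow> 'a \<Rightarrow> nat" where
  "hdeg H i = card {h \<in> H. i \<in> verts_of h}"

definition hyperedge_diff :: "('a \<Rightarrow> real) \<Rightarrow> 'a set \<times> 'a set \<Rightarrow> real" where
  "hyperedge_diff f h = (\<Sum>i\<in>fst h. f i) - (\<Sum>j\<in>snd h. f j)"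

definition laplacian :: "('a set \<times> 'a set) set \<Rightarrow> ('a \<Rightarrow> real) \<Rightarrow> 'a \<Rightarrow> real" where
  "laplacian H f i =
     1 / real (hdeg H i) *
       ((\<Sum>h | h \<in> H \<and> i \<in> fst h. hyperedge_diff f h)
        - (\<Sum>h | h \<in> H \<and> i \<in> snd h. hyperedge_diff f h))"

text \<open>
  A function on \<open>V\<close> is represented by a total function whose values outside \<open>V\<close> are irrelevant;
  hence both the eigenvalue equation and the condition that \<open>f\<close> is nonzero are relativised to \<open>V\<close>.
\<close>

definition laplacian_spectrum :: "'a set \<Rightarrow> ('a set \<times> 'a set) set \<Rightarrow> real set" where
  "laplacian_spectrum V H =
     {\<mu>. \<exists>f. (\<exists>i\<in>V. f i \<noteq> 0) \<and> (\<forall>i\<in>V. laplacian H f i = \<mu> * f i)}"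

definition lambda_min :: "'a set \<Rightarrow> ('a set \<times> 'a set) set \<Rightarrow> real" where
  "lambda_min V H = Min (laplacian_spectrum V H)"

definition lambda_max :: "'a set \<Rightarrow> ('a set \<times> 'a set) set \<Rightarrow> real" where
  "lambda_max V H = Max (laplacian_spectrum V H)"

definition proper_coloring ::
  "'a set \<Rightarrow> ('a set \<times> 'a set) set \<Rightarrow> nat \<Rightarrow> ('a \<Rightarrow> nat) \<Rightarrow> bool" where
  "proper_coloring V H k c \<longleftrightarrow>
     c ` V \<subseteq> {1..k} \<and>
     (\<forall>i\<in>V. \<forall>j\<in>V. i \<noteq> j \<longrightarrow> (\<exists>h\<in>H. i \<in> verts_of h \<and> j \<in> verts_of h) \<longrightarrow> c i \<noteq> c j)"

definition coloring_number :: "'a set \<Rightarrow> ('a set \<times> 'a set) set \<Rightarrow> nat" where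
  "coloring_number V H = (LEAST k. \<exists>c. proper_coloring V H k c)"

definition restrict_hyperedges ::
  "('a set \<times> 'a set) set \<Rightarrow> 'a set \<Rightarrow> ('a set \<times> 'a set) set" where
  "restrict_hyperedges H S = (\<lambda>h. (fst h \<inter> S, snd h \<inter> S)) ` H"

definition sub_coloring_number :: "('a set \<times> 'a set) set \<Rightarrow> 'a set \<Rightarrow> nat" where
  "sub_coloring_number H S = coloring_number S (restrict_hyperedges H S)"

definition vol :: "('a set \<times> 'a set) set \<Rightarrow> 'a set \<Rightarrow> nat" where
  "vol H S = (\<Sum>i\<in>S. hdeg H i)"

definition e_tilde :: "('a set \<times> 'a set) set \<Rightarrow> 'a set \<Rightarrow> real" where
  "e_tilde H S = (\<Sum>h\<in>H. (real (card (fst h \<inter> S)) - real (card (snd h \<inter> S)))\<^sup>2)"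

definition h_tilde' :: "'a set \<Rightarrow> ('a set \<times> 'a set) set \<Rightarrow> real" where
  "h_tilde' V H = Min {e_tilde H S / real (vol H S) | S. S \<noteq> {} \<and> S \<subseteq> V}"

lemma sub_coloring_number_all:
  assumes "oriented_hypergraph V H"
  shows "sub_coloring_number H V = coloring_number V H"
proof -
  have "(fst h \<inter> V, snd h \<inter> V) = h" if "h \<in> H" for h
    using assms that by (cases h) (auto simp: oriented_hypergraph_def)
  then have "restrict_hyperedges H V = H"
    by (simp add: restrict_hyperedges_def)
  then show ?thesis
    by (simp add: sub_coloring_number_def)
qed

end

theory Submission
  imports Defs "HOL-Analysis.Function_Topology"
begin

text \<open>
  After multiplication by the degrees, the Laplacian is the Gram matrix of the incidence matrix, so
  all Rayleigh quotients (energy over degree-weighted square norm) lie between the extreme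
  eigenvalues. Given a proper \<open>k\<close>-coloring of \<open>S\<close>, take for every color \<open>l\<close> the test function that is
  \<open>1 - k\<close> on the vertices of \<open>S\<close> with color \<open>l\<close>, \<open>1\<close> on the rest of \<open>S\<close> and \<open>0\<close> elsewhere. A
  hyperedge meets each color class at most once, so the energies sum to
  \<open>k\<^sup>2 vol(S) - k e(S)\<close> and the square norms to \<open>(k\<^sup>2 - k) vol(S)\<close>; the quotient of these two sums
  is the claimed bound. As \<open>k\<close> need not be minimal, the bound involving the minimum over all \<open>S\<close>
  follows by restricting an optimal coloring of \<open>V\<close> to a minimizing \<open>S\<close>.
\<close>

section \<open>Rayleigh quotients of a symmetric form with diagonal weights\<close>

definition weighted_sqnorm :: "'a set \<Rightarrow> ('a \<Rightarrow> real) \<Rightarrow> ('a \<Rightarrow> real) \<Rightarrow> real" where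
  "weighted_sqnorm V w f = (\<Sum>i\<in>V. w i * (f i)\<^sup>2)"

definition quad_form :: "'a set \<Rightarrow> ('a \<Rightarrow> 'a \<Rightarrow> real) \<Rightarrow> ('a \<Rightarrow> real) \<Rightarrow> real" where
  "quad_form V A f = (\<Sum>i\<in>V. \<Sum>j\<in>V. A i j * f i * f j)"

text \<open>The generalized eigenvalue problem \<open>A f = \<mu> W f\<close> with \<open>W\<close>
  the diagonal matrix of \<open>w\<close>. Keeping the weight on the right preserves the symmetry of
  \<open>A\<close>, which dividing by the weights would destroy.\<close>

definition pencil_spectrum :: "'a set \<Rightarrow> ('a \<Rightarrow> 'a \<Rightarrow> real) \<Rightarrow> ('a \<Rightarrow> real) \<Rightarrow> real set" where
  "pencil_spectrum V A w =
     {\<mu>. \<exists>f. (\<exists>i\<in>V. f i \<noteq> 0) \<and> (\<forall>i\<in>V. (\<Sum>j\<in>V. A i j * f j) = \<mu> * (w i * f i))}"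

lemma weighted_sqnorm_pos:
  assumes "finite V" "\<And>i. i \<in> V \<Longrightarrow> w i > 0" "\<exists>i\<in>V. f i \<noteq> 0"
  shows "weighted_sqnorm V w f > 0"
proof -
  from assms(3) obtain i where i: "i \<in> V" "f i \<noteq> 0" by blast
  show ?thesis
    unfolding weighted_sqnorm_def
    using i assms(1,2) by (intro sum_pos2[of V i]) (auto simp: less_imp_le)
qed

lemma quad_form_scale: "quad_form V A (\<lambda>i. c * f i) = c\<^sup>2 * quad_form V A f"
  by (simp add: quad_form_def sum_distrib_left power2_eq_square mult_ac)

lemma weighted_sqnorm_scale: "weighted_sqnorm V w (\<lambda>i. c * f i) = c\<^sup>2 * weighted_sqnorm V w f"
  by (simp add: weighted_sqnorm_def sum_distrib_left power2_eq_square mult_ac)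

text \<open>Tychonoff: the sphere is a closed subset of a product of compact intervals. Fixing the
  value 0 outside \<open>V\<close> is what bounds the coordinates that the norm does not
  see.\<close>

lemma compact_weighted_sphere:
  assumes "finite V" "\<And>i. i \<in> V \<Longrightarrow> w i > 0"
  shows "compact {f. (\<forall>i. i \<notin> V \<longrightarrow> f i = 0) \<and> weighted_sqnorm V w f = 1}"
proof -
  \<comment> \<open>The sharp radius is \<open>1 / sqrt (w i)\<close>. The larger
    \<open>1 + 1 / w i\<close> avoids the root: it is at least 1, hence at most its own
    square.\<close>
  define B where "B i = (if i \<in> V then {- (1 + 1 / w i)..1 + 1 / w i} else {0})" for i
  have "compactin (product_topology (\<lambda>_. euclidean) UNIV) (PiE UNIV B)"
    by (auto simp: compactin_PiE B_def)
  then have 1: "compact (PiE UNIV B)"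
    by (simp add: euclidean_product_topology)
  have "closed {f. weighted_sqnorm V w f = 1}"
    unfolding weighted_sqnorm_def
    by (intro closed_Collect_eq continuous_intros continuous_on_product_coordinates)
  with 1 have 2: "compact (PiE UNIV B \<inter> {f. weighted_sqnorm V w f = 1})"
    by (rule compact_Int_closed)
  have "\<bar>f i\<bar> \<le> 1 + 1 / w i" if "weighted_sqnorm V w f = 1" "i \<in> V" for f i
  proof -
    have w: "w i > 0" using assms that by auto
    have "w i * (f i)\<^sup>2 \<le> weighted_sqnorm V w f"
      unfolding weighted_sqnorm_def
      using assms that by (intro member_le_sum) (auto simp: less_imp_le)
    then have "(f i)\<^sup>2 \<le> 1 / w i"
      using that w by (simp add: field_simps)
    also have "\<dots> \<le> 1 + 1 / w i"
      by simp
    also have "\<dots> \<le> (1 + 1 / w i)\<^sup>2"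
      using w by (intro self_le_power) auto
    finally show ?thesis
      using w by (simp add: abs_le_square_iff[symmetric])
  qed
  then have "{f. (\<forall>i. i \<notin> V \<longrightarrow> f i = 0) \<and> weighted_sqnorm V w f = 1}
      = PiE UNIV B \<inter> {f. weighted_sqnorm V w f = 1}"
    unfolding B_def PiE_def Pi_def by (force simp: abs_le_iff split: if_splits)
  with 2 show ?thesis by simp
qed

text \<open>A continuous form attains its maximum on the compact sphere, and homogeneity of degree 2
  carries the bound to every \<open>f\<close>. The product form of the bound also covers functions
  vanishing on \<open>V\<close>.\<close>

lemma rayleigh_maximum:
  assumes "finite V" "V \<noteq> {}" "\<And>i. i \<in> V \<Longrightarrow> w i > 0"
  obtains g where "weighted_sqnorm V w g = 1"
    "\<And>f. quad_form V A f \<le> quad_form V A g * weighted_sqnorm V w f"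
proof -
  define K where "K = {f. (\<forall>i. i \<notin> V \<longrightarrow> f i = 0) \<and> weighted_sqnorm V w f = 1}"
  \<comment> \<open>Cut off outside \<open>V\<close>, then scale to the sphere; neither form depends
    on values outside \<open>V\<close>.\<close>
  define nrm where
    "nrm f = (\<lambda>i. 1 / sqrt (weighted_sqnorm V w f) * (if i \<in> V then f i else 0))" for f
  have res: "quad_form V A (\<lambda>i. if i \<in> V then f i else 0) = quad_form V A f"
    "weighted_sqnorm V w (\<lambda>i. if i \<in> V then f i else 0) = weighted_sqnorm V w f" for f
    by (auto simp: quad_form_def weighted_sqnorm_def intro!: sum.cong)
  have nrm: "nrm f \<in> K" "quad_form V A (nrm f) = quad_form V A f / weighted_sqnorm V w f"
    if "\<exists>i\<in>V. f i \<noteq> 0" for f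
  proof -
    have pos: "weighted_sqnorm V w f > 0"
      using weighted_sqnorm_pos[OF assms(1,3) that] by simp
    have sq: "(1 / sqrt (weighted_sqnorm V w f))\<^sup>2 = 1 / weighted_sqnorm V w f"
      using pos by (simp add: power_divide)
    show "nrm f \<in> K"
      using pos unfolding K_def nrm_def mem_Collect_eq weighted_sqnorm_scale res sq by simp
    show "quad_form V A (nrm f) = quad_form V A f / weighted_sqnorm V w f"
      unfolding nrm_def quad_form_scale res sq by simp
  qed
  have "compact K"
    unfolding K_def by (rule compact_weighted_sphere) (use assms in auto)
  moreover have "K \<noteq> {}"
    using nrm(1)[of "\<lambda>_. 1"] assms(2) by auto
  moreover have "continuous_on K (quad_form V A)"
    unfolding quad_form_def
    by (intro continuous_intros continuous_on_subset[OF continuous_on_product_coordinates]) auto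
  ultimately obtain g where g: "g \<in> K" "\<And>f. f \<in> K \<Longrightarrow> quad_form V A f \<le> quad_form V A g"
    using continuous_attains_sup by metis
  have "quad_form V A f \<le> quad_form V A g * weighted_sqnorm V w f" for f
  proof (cases "\<exists>i\<in>V. f i \<noteq> 0")
    case True
    then show ?thesis
      using g(2)[OF nrm(1)[OF True]] nrm(2)[OF True] weighted_sqnorm_pos[OF assms(1,3) True]
      by (simp add: divide_le_eq)
  next
    case False
    then show ?thesis
      by (simp add: quad_form_def weighted_sqnorm_def)
  qed
  with g(1) that show thesis
    by (auto simp: K_def)
qed

text \<open>First-order condition: the polynomial has a minimum at \<open>t = 0\<close>, so its
  derivative there vanishes.\<close>

lemma linear_coeff_zero:
  fixes a b :: real
  assumes "\<And>t. 0 \<le> t * a + t\<^sup>2 * b"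
  shows "a = 0"
proof (rule ccontr)
  assume "a \<noteq> 0"
  \<comment> \<open>A step \<open>t = - s * a\<close> against the slope contradicts nonnegativity
    once \<open>s * b < 1\<close>.\<close>
  define s where "s = 1 / (1 + \<bar>b\<bar>)"
  have s: "s > 0" "s * b < 1"
    by (auto simp: s_def field_simps)
  have "0 \<le> (- s * a) * a + (- s * a)\<^sup>2 * b"
    by (rule assms)
  also have "\<dots> = s * a\<^sup>2 * (s * b - 1)"
    by (simp add: algebra_simps power2_eq_square)
  also have "\<dots> < 0"
    using s \<open>a \<noteq> 0\<close> by (intro mult_pos_neg) auto
  finally show False by simp
qed

text \<open>Serves twice: for the variation of a Rayleigh maximizer in one coordinate, and with
  \<open>t = - 1\<close> for Bessel's inequality.\<close>

lemma weighted_sqnorm_add_delta: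
  assumes "finite V" "k \<in> V"
  shows "weighted_sqnorm V w (\<lambda>i. f i + (if i = k then t else 0))
    = weighted_sqnorm V w f + t * (2 * (w k * f k)) + t\<^sup>2 * w k"
proof -
  have "w i * (f i + (if i = k then t else 0))\<^sup>2
      = w i * (f i)\<^sup>2 + (if i = k then t * (2 * (w k * f k)) + t\<^sup>2 * w k else 0)" for i
    by (simp add: power2_eq_square algebra_simps)
  then show ?thesis
    using assms by (simp add: weighted_sqnorm_def sum.distrib)
qed

lemma quad_form_add_delta:
  assumes "finite V" "k \<in> V" "\<And>i j. A i j = A j i"
  shows "quad_form V A (\<lambda>i. f i + (if i = k then t else 0))
    = quad_form V A f + t * (2 * (\<Sum>j\<in>V. A k j * f j)) + t\<^sup>2 * A k k"
proof -
  \<comment> \<open>The conditionals are nested so that each double sum collapses at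
    \<open>k\<close>; symmetry lets both cross terms be read off row \<open>k\<close>.\<close>
  have "A i j * (f i + (if i = k then t else 0)) * (f j + (if j = k then t else 0))
      = A i j * f i * f j + (if i = k then t * A k j * f j else 0)
        + (if j = k then t * A k i * f i + (if i = k then t\<^sup>2 * A k k else 0) else 0)" for i j
    using assms(3)[of i k] by (simp add: power2_eq_square algebra_simps)
  moreover have "(\<Sum>j\<in>V. if i = k then t * A k j * f j else 0)
      = (if i = k then t * (\<Sum>j\<in>V. A k j * f j) else 0)" for i
    by (simp add: sum_distrib_left mult_ac)
  moreover have "(\<Sum>i\<in>V. t * A k i * f i) = t * (\<Sum>j\<in>V. A k j * f j)"
    by (simp add: sum_distrib_left mult_ac)
  ultimately show ?thesis
    using assms(1,2) by (simp add: quad_form_def sum.distrib)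
qed

text \<open>A maximizer \<open>g\<close> of the Rayleigh quotient is an eigenvector:
  \<open>\<mu>\<close> times the square norm minus the form is nonnegative and vanishes at
  \<open>g\<close>, so its linear coefficient in every coordinate direction is zero. Coordinate by
  coordinate this is the eigenvalue equation.\<close>

lemma pencil_spectrum_dominates:
  assumes "finite V" "V \<noteq> {}" "\<And>i. i \<in> V \<Longrightarrow> w i > 0" "\<And>i j. A i j = A j i"
  obtains \<mu> where "\<mu> \<in> pencil_spectrum V A w"
    "\<And>f. quad_form V A f \<le> \<mu> * weighted_sqnorm V w f"
proof -
  obtain g where g: "weighted_sqnorm V w g = 1"
    "\<And>f. quad_form V A f \<le> quad_form V A g * weighted_sqnorm V w f"
    using rayleigh_maximum[of V w A] assms(1-3) by blast
  define \<mu> where "\<mu> = quad_form V A g"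
  have "(\<Sum>j\<in>V. A k j * g j) = \<mu> * (w k * g k)" if k: "k \<in> V" for k
  proof -
    have "2 * (\<mu> * (w k * g k) - (\<Sum>j\<in>V. A k j * g j)) = 0"
    proof (rule linear_coeff_zero)
      fix t
      show "0 \<le> t * (2 * (\<mu> * (w k * g k) - (\<Sum>j\<in>V. A k j * g j))) + t\<^sup>2 * (\<mu> * w k - A k k)"
        using g(2)[of "\<lambda>i. g i + (if i = k then t else 0)"] g(1)
        unfolding quad_form_add_delta[OF assms(1) k assms(4)]
          weighted_sqnorm_add_delta[OF assms(1) k] \<mu>_def[symmetric]
        by (simp add: algebra_simps)
    qed
    then show ?thesis by simp
  qed
  moreover have "\<exists>i\<in>V. g i \<noteq> 0"
  proof (rule ccontr)
    assume "\<not> ?thesis"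
    then have "weighted_sqnorm V w g = 0" by (simp add: weighted_sqnorm_def)
    with g(1) show False by simp
  qed
  ultimately have "\<mu> \<in> pencil_spectrum V A w"
    by (auto simp: pencil_spectrum_def)
  with g(2) that show thesis
    unfolding \<mu>_def by blast
qed

section \<open>Orthogonality of eigenvectors and finiteness of the spectrum\<close>

text \<open>
  Bessel's inequality for the coordinate functions, summed over \<open>V\<close>; this is what makes the spectrum
  finite, so that \<open>Min\<close> and \<open>Max\<close> of it are meaningful.
\<close>

lemma card_orthonormal_le:
  assumes "finite V" "\<And>i. i \<in> V \<Longrightarrow> w i > 0" "finite E"
    and orth: "\<And>\<mu> \<nu>. \<mu> \<in> E \<Longrightarrow> \<nu> \<in> E \<Longrightarrow>
      (\<Sum>i\<in>V. w i * g \<mu> i * g \<nu> i) = (if \<mu> = \<nu> then 1 else (0::real))"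
  shows "card E \<le> card V"
proof -
  have bessel: "w k * (\<Sum>\<mu>\<in>E. (g \<mu> k)\<^sup>2) \<le> 1" if k: "k \<in> V" for k
  proof -
    \<comment> \<open>\<open>G\<close> is the weighted orthogonal projection of the indicator of
      \<open>k\<close> onto the span of the family; \<open>w k * g \<mu> k\<close> is the inner
      product of that indicator with \<open>g \<mu>\<close>.\<close>
    define G where "G i = (\<Sum>\<mu>\<in>E. (w k * g \<mu> k) * g \<mu> i)" for i
    define s where "s = (\<Sum>\<mu>\<in>E. (w k * g \<mu> k)\<^sup>2)"
    have "w i * (G i)\<^sup>2 = (\<Sum>\<mu>\<in>E. \<Sum>\<nu>\<in>E. (w k * g \<mu> k) * (w k * g \<nu> k) * (w i * g \<mu> i * g \<nu> i))" for i
      by (simp add: G_def power2_eq_square sum_product sum_distrib_left mult_ac)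
    then have "weighted_sqnorm V w G
        = (\<Sum>i\<in>V. \<Sum>\<mu>\<in>E. \<Sum>\<nu>\<in>E. (w k * g \<mu> k) * (w k * g \<nu> k) * (w i * g \<mu> i * g \<nu> i))"
      by (simp add: weighted_sqnorm_def)
    also have "\<dots> = (\<Sum>\<mu>\<in>E. \<Sum>i\<in>V. \<Sum>\<nu>\<in>E. (w k * g \<mu> k) * (w k * g \<nu> k) * (w i * g \<mu> i * g \<nu> i))"
      by (rule sum.swap)
    also have "\<dots> = (\<Sum>\<mu>\<in>E. \<Sum>\<nu>\<in>E. \<Sum>i\<in>V. (w k * g \<mu> k) * (w k * g \<nu> k) * (w i * g \<mu> i * g \<nu> i))"
      by (intro sum.cong sum.swap refl)
    also have "\<dots> = (\<Sum>\<mu>\<in>E. \<Sum>\<nu>\<in>E. if \<mu> = \<nu> then (w k * g \<mu> k)\<^sup>2 else 0)"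
      by (intro sum.cong refl) (simp only: sum_distrib_left[symmetric] orth, auto simp: power2_eq_square)
    also have "\<dots> = s"
      using assms(3) by (simp add: s_def)
    finally have norm_G: "weighted_sqnorm V w G = s" .
    have "w k * G k = s"
      by (simp add: G_def s_def sum_distrib_left power2_eq_square mult_ac)
    \<comment> \<open>The square norm of \<open>G\<close> minus the indicator expands to
      \<open>s - 2 * s + w k\<close>.\<close>
    moreover have "0 \<le> weighted_sqnorm V w (\<lambda>i. G i + (if i = k then - 1 else 0))"
      unfolding weighted_sqnorm_def
      using assms(2) by (intro sum_nonneg) (auto simp: less_imp_le)
    ultimately have "s \<le> w k"
      unfolding weighted_sqnorm_add_delta[OF assms(1) k] norm_G by simp
    moreover have "s = w k * (w k * (\<Sum>\<mu>\<in>E. (g \<mu> k)\<^sup>2))"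
      by (simp add: s_def sum_distrib_left power2_eq_square mult_ac)
    ultimately show ?thesis
      using assms(2)[OF k] by simp
  qed
  have "real (card E) = (\<Sum>\<mu>\<in>E. \<Sum>i\<in>V. w i * g \<mu> i * g \<mu> i)"
    by (simp add: orth)
  also have "\<dots> = (\<Sum>i\<in>V. w i * (\<Sum>\<mu>\<in>E. (g \<mu> i)\<^sup>2))"
    by (subst sum.swap) (simp add: sum_distrib_left power2_eq_square mult_ac)
  also have "\<dots> \<le> (\<Sum>i\<in>V. 1)"
    by (intro sum_mono bessel)
  finally show ?thesis by simp
qed

text \<open>Evaluating the bilinear form of \<open>A\<close> at \<open>f\<close> and
  \<open>g\<close> from either side multiplies their weighted inner product once by
  \<open>\<mu>\<close> and once by \<open>\<nu>\<close>.\<close>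

lemma pencil_eigenvectors_orthogonal:
  assumes sym: "\<And>i j. A i j = A j i" and "\<mu> \<noteq> \<nu>"
    and f: "\<And>i. i \<in> V \<Longrightarrow> (\<Sum>j\<in>V. A i j * f j) = \<mu> * (w i * f i)"
    and g: "\<And>i. i \<in> V \<Longrightarrow> (\<Sum>j\<in>V. A i j * g j) = \<nu> * (w i * g i)"
  shows "(\<Sum>i\<in>V. w i * f i * g i) = (0::real)"
proof -
  have "\<mu> * (\<Sum>i\<in>V. w i * f i * g i) = (\<Sum>i\<in>V. g i * (\<Sum>j\<in>V. A i j * f j))"
    unfolding sum_distrib_left[of \<mu>] by (intro sum.cong refl) (simp add: f)
  also have "\<dots> = (\<Sum>j\<in>V. \<Sum>i\<in>V. g i * (A i j * f j))"
    by (subst sum.swap) (simp add: sum_distrib_left)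
  also have "\<dots> = (\<Sum>j\<in>V. f j * (\<Sum>i\<in>V. A j i * g i))"
    using sym by (simp add: sum_distrib_left mult_ac)
  also have "\<dots> = \<nu> * (\<Sum>i\<in>V. w i * f i * g i)"
    unfolding sum_distrib_left[of \<nu>] by (intro sum.cong refl) (simp add: g)
  finally show ?thesis using \<open>\<mu> \<noteq> \<nu>\<close> by simp
qed

text \<open>One unit eigenvector per eigenvalue gives an orthonormal family, so no finite set of
  eigenvalues has more than \<open>card V\<close> elements.\<close>

lemma finite_pencil_spectrum:
  assumes "finite V" "\<And>i. i \<in> V \<Longrightarrow> w i > 0" "\<And>i j. A i j = A j i"
  shows "finite (pencil_spectrum V A w)"
proof -
  have "\<exists>f. weighted_sqnorm V w f = 1 \<and> (\<forall>i\<in>V. (\<Sum>j\<in>V. A i j * f j) = \<mu> * (w i * f i))"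
    if \<mu>: "\<mu> \<in> pencil_spectrum V A w" for \<mu>
  proof -
    from \<mu> obtain f where f: "\<exists>i\<in>V. f i \<noteq> 0" "\<forall>i\<in>V. (\<Sum>j\<in>V. A i j * f j) = \<mu> * (w i * f i)"
      by (auto simp: pencil_spectrum_def)
    define c where "c = 1 / sqrt (weighted_sqnorm V w f)"
    have pos: "weighted_sqnorm V w f > 0"
      using weighted_sqnorm_pos[OF assms(1,2) f(1)] by simp
    have "weighted_sqnorm V w (\<lambda>i. c * f i) = 1"
      using pos unfolding weighted_sqnorm_scale by (simp add: c_def power_divide)
    moreover have "(\<Sum>j\<in>V. A i j * (c * f j)) = \<mu> * (w i * (c * f i))" if "i \<in> V" for i
    proof -
      have "(\<Sum>j\<in>V. A i j * (c * f j)) = c * (\<Sum>j\<in>V. A i j * f j)"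
        by (simp add: sum_distrib_left mult_ac)
      with f(2) that show ?thesis by simp
    qed
    ultimately show ?thesis by blast
  qed
  then obtain g where g: "\<And>\<mu>. \<mu> \<in> pencil_spectrum V A w \<Longrightarrow> weighted_sqnorm V w (g \<mu>) = 1"
    "\<And>\<mu> i. \<mu> \<in> pencil_spectrum V A w \<Longrightarrow> i \<in> V \<Longrightarrow>
      (\<Sum>j\<in>V. A i j * g \<mu> j) = \<mu> * (w i * g \<mu> i)"
    by metis
  have card_le: "card E \<le> card V" if E: "finite E" "E \<subseteq> pencil_spectrum V A w" for E
  proof (rule card_orthonormal_le[OF assms(1,2) E(1)])
    fix \<mu> \<nu> assume "\<mu> \<in> E" "\<nu> \<in> E"
    with E g show "(\<Sum>i\<in>V. w i * g \<mu> i * g \<nu> i) = (if \<mu> = \<nu> then 1 else 0)"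
      using pencil_eigenvectors_orthogonal[of A \<mu> \<nu> V "g \<mu>" w "g \<nu>", OF assms(3)]
      by (auto simp: weighted_sqnorm_def power2_eq_square mult.assoc subset_iff)
  qed auto
  show ?thesis
  proof (rule ccontr)
    assume "infinite (pencil_spectrum V A w)"
    then obtain E where "finite E" "card E = Suc (card V)" "E \<subseteq> pencil_spectrum V A w"
      using infinite_arbitrarily_large by blast
    with card_le show False by fastforce
  qed
qed

section \<open>Rayleigh bounds by the extreme eigenvalues\<close>

lemma rayleigh_le_Max:
  assumes "finite V" "V \<noteq> {}" "\<And>i. i \<in> V \<Longrightarrow> w i > 0" "\<And>i j. A i j = A j i"
  shows "quad_form V A f \<le> Max (pencil_spectrum V A w) * weighted_sqnorm V w f"
proof -
  obtain \<mu> where \<mu>: "\<mu> \<in> pencil_spectrum V A w"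
    "\<And>f. quad_form V A f \<le> \<mu> * weighted_sqnorm V w f"
    using pencil_spectrum_dominates[of V w A] assms by blast
  have "finite (pencil_spectrum V A w)"
    by (rule finite_pencil_spectrum) (use assms in auto)
  with \<mu>(1) have "\<mu> \<le> Max (pencil_spectrum V A w)"
    by simp
  moreover have "weighted_sqnorm V w f \<ge> 0"
    unfolding weighted_sqnorm_def using assms(3) by (intro sum_nonneg) (auto simp: less_imp_le)
  ultimately show ?thesis
    using \<mu>(2)[of f] mult_right_mono by fastforce
qed

text \<open>Negating \<open>A\<close> negates its spectrum and its form, so the dominating
  eigenvalue of \<open>- A\<close> yields the lower bound.\<close>

lemma rayleigh_ge_Min:
  assumes "finite V" "V \<noteq> {}" "\<And>i. i \<in> V \<Longrightarrow> w i > 0" "\<And>i j. A i j = A j i"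
  shows "Min (pencil_spectrum V A w) * weighted_sqnorm V w f \<le> quad_form V A f"
proof -
  obtain \<mu> where \<mu>: "\<mu> \<in> pencil_spectrum V (\<lambda>i j. - A i j) w"
    "\<And>f. quad_form V (\<lambda>i j. - A i j) f \<le> \<mu> * weighted_sqnorm V w f"
    using pencil_spectrum_dominates[of V w "\<lambda>i j. - A i j"] assms by auto
  have "- \<mu> \<in> pencil_spectrum V A w"
    using \<mu>(1) by (auto simp: pencil_spectrum_def sum_negf minus_equation_iff)
  moreover have "finite (pencil_spectrum V A w)"
    by (rule finite_pencil_spectrum) (use assms in auto)
  ultimately have "Min (pencil_spectrum V A w) \<le> - \<mu>"
    by simp
  moreover have "weighted_sqnorm V w f \<ge> 0"
    unfolding weighted_sqnorm_def using assms(3) by (intro sum_nonneg) (auto simp: less_imp_le)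
  moreover have "quad_form V (\<lambda>i j. - A i j) f = - quad_form V A f"
    by (simp add: quad_form_def sum_negf)
  ultimately show ?thesis
    using \<mu>(2)[of f] mult_right_mono[of "Min (pencil_spectrum V A w)" "- \<mu>" "weighted_sqnorm V w f"]
    by simp
qed


section \<open>The Laplacian as a Gram matrix\<close>

text \<open>A difference of two indicators, to match the in-sum minus the out-sum in
  \<open>hyperedge_diff\<close>, \<open>laplacian\<close> and \<open>e_tilde\<close>.\<close>

definition incidence :: "'a set \<times> 'a set \<Rightarrow> 'a \<Rightarrow> real" where
  "incidence h i = (if i \<in> fst h then 1 else 0) - (if i \<in> snd h then 1 else 0)"

definition incidence_gram :: "('a set \<times> 'a set) set \<Rightarrow> 'a \<Rightarrow> 'a \<Rightarrow> real" where
  "incidence_gram H i j = (\<Sum>h\<in>H. incidence h i * incidence h j)"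

lemma finite_hyperedges:
  assumes "oriented_hypergraph V H"
  shows "finite H"
proof (rule finite_subset)
  show "H \<subseteq> Pow V \<times> Pow V"
    using assms by (auto simp: oriented_hypergraph_def)
  show "finite (Pow V \<times> Pow V)"
    using assms by (simp add: oriented_hypergraph_def)
qed

lemma hyperedge_diff_incidence:
  assumes "oriented_hypergraph V H" "h \<in> H"
  shows "hyperedge_diff f h = (\<Sum>i\<in>V. incidence h i * f i)"
proof -
  have sub: "fst h \<subseteq> V" "snd h \<subseteq> V" and V: "finite V"
    using assms by (cases h; auto simp: oriented_hypergraph_def)+
  have "incidence h i * f i = (if i \<in> fst h then f i else 0) - (if i \<in> snd h then f i else 0)" for i
    by (simp add: incidence_def)
  then show ?thesis
    using sub V
    by (simp add: hyperedge_diff_def sum_subtractf sum.inter_restrict[symmetric] Int_absorb1)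
qed

text \<open>The numbers \<open>hyperedge_diff f h\<close> are the entries of the transposed
  incidence matrix applied to \<open>f\<close>, and the outer signed sum over hyperedges applies the
  incidence matrix again.\<close>

lemma laplacian_incidence_gram:
  assumes "oriented_hypergraph V H" "hdeg H i \<noteq> 0"
  shows "real (hdeg H i) * laplacian H f i = (\<Sum>j\<in>V. incidence_gram H i j * f j)"
proof -
  have H: "finite H" using finite_hyperedges[OF assms(1)] .
  have "real (hdeg H i) * laplacian H f i
      = (\<Sum>h | h \<in> H \<and> i \<in> fst h. hyperedge_diff f h) - (\<Sum>h | h \<in> H \<and> i \<in> snd h. hyperedge_diff f h)"
    using assms(2) by (simp add: laplacian_def)
  also have "\<dots> = (\<Sum>h\<in>H. (if i \<in> fst h then hyperedge_diff f h else 0)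
      - (if i \<in> snd h then hyperedge_diff f h else 0))"
    using H by (simp add: sum.inter_filter sum_subtractf)
  also have "\<dots> = (\<Sum>h\<in>H. incidence h i * hyperedge_diff f h)"
    by (intro sum.cong refl) (simp add: incidence_def)
  also have "\<dots> = (\<Sum>h\<in>H. \<Sum>j\<in>V. incidence h i * (incidence h j * f j))"
    by (intro sum.cong refl) (simp add: hyperedge_diff_incidence[OF assms(1)] sum_distrib_left)
  also have "\<dots> = (\<Sum>j\<in>V. incidence_gram H i j * f j)"
    by (subst sum.swap) (simp add: incidence_gram_def sum_distrib_right mult.assoc)
  finally show ?thesis .
qed

lemma laplacian_spectrum_pencil:
  assumes "oriented_hypergraph V H" "\<forall>i\<in>V. hdeg H i \<noteq> 0"
  shows "laplacian_spectrum V H = pencil_spectrum V (incidence_gram H) (\<lambda>i. real (hdeg H i))"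
proof -
  have "laplacian H f i = \<mu> * f i \<longleftrightarrow>
      (\<Sum>j\<in>V. incidence_gram H i j * f j) = \<mu> * (real (hdeg H i) * f i)" if "i \<in> V" for f i \<mu>
  proof -
    have "laplacian H f i = \<mu> * f i \<longleftrightarrow>
        real (hdeg H i) * laplacian H f i = real (hdeg H i) * (\<mu> * f i)"
      using assms(2) that by (metis mult_left_cancel of_nat_eq_0_iff)
    also have "\<dots> \<longleftrightarrow> (\<Sum>j\<in>V. incidence_gram H i j * f j) = \<mu> * (real (hdeg H i) * f i)"
      using laplacian_incidence_gram[OF assms(1)] assms(2) that by (simp add: mult_ac)
    finally show ?thesis .
  qed
  then show ?thesis
    by (simp add: laplacian_spectrum_def pencil_spectrum_def)
qed

lemma quad_form_incidence_gram:
  assumes "oriented_hypergraph V H"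
  shows "quad_form V (incidence_gram H) f = (\<Sum>h\<in>H. (hyperedge_diff f h)\<^sup>2)"
proof -
  have "quad_form V (incidence_gram H) f
      = (\<Sum>i\<in>V. \<Sum>j\<in>V. \<Sum>h\<in>H. (incidence h i * f i) * (incidence h j * f j))"
    by (simp add: quad_form_def incidence_gram_def sum_distrib_left mult_ac)
  also have "\<dots> = (\<Sum>i\<in>V. \<Sum>h\<in>H. \<Sum>j\<in>V. (incidence h i * f i) * (incidence h j * f j))"
    by (intro sum.cong refl sum.swap)
  also have "\<dots> = (\<Sum>h\<in>H. \<Sum>i\<in>V. \<Sum>j\<in>V. (incidence h i * f i) * (incidence h j * f j))"
    by (rule sum.swap)
  also have "\<dots> = (\<Sum>h\<in>H. (hyperedge_diff f h)\<^sup>2)"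
    by (intro sum.cong refl)
      (simp add: hyperedge_diff_incidence[OF assms] power2_eq_square sum_product)
  finally show ?thesis .
qed

text \<open>Stated without division, so that the bounds can be added over several test
  functions.\<close>

lemma laplacian_rayleigh_bounds:
  assumes "oriented_hypergraph V H" "\<forall>i\<in>V. hdeg H i \<noteq> 0" "V \<noteq> {}"
  shows "lambda_min V H * weighted_sqnorm V (\<lambda>i. real (hdeg H i)) f \<le> (\<Sum>h\<in>H. (hyperedge_diff f h)\<^sup>2)"
    and "(\<Sum>h\<in>H. (hyperedge_diff f h)\<^sup>2) \<le> lambda_max V H * weighted_sqnorm V (\<lambda>i. real (hdeg H i)) f"
proof -
  have *: "finite V" "\<And>i. i \<in> V \<Longrightarrow> real (hdeg H i) > 0"
    "\<And>i j. incidence_gram H i j = incidence_gram H j i"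
    using assms by (auto simp: oriented_hypergraph_def incidence_gram_def mult.commute)
  note eqs = lambda_min_def lambda_max_def laplacian_spectrum_pencil[OF assms(1,2)]
    quad_form_incidence_gram[OF assms(1), symmetric]
  show "lambda_min V H * weighted_sqnorm V (\<lambda>i. real (hdeg H i)) f \<le> (\<Sum>h\<in>H. (hyperedge_diff f h)\<^sup>2)"
    unfolding eqs by (rule rayleigh_ge_Min) (use * assms(3) in auto)
  show "(\<Sum>h\<in>H. (hyperedge_diff f h)\<^sup>2) \<le> lambda_max V H * weighted_sqnorm V (\<lambda>i. real (hdeg H i)) f"
    unfolding eqs by (rule rayleigh_le_Max) (use * assms(3) in auto)
qed

text \<open>Disjointness of the two sides excludes cancellation, so incidences on the hyperedge are
  1 or -1.\<close>

lemma incidence_sqr: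
  assumes "oriented_hypergraph V H" "h \<in> H"
  shows "(incidence h i)\<^sup>2 = (if i \<in> verts_of h then 1 else 0)"
  using assms by (cases h) (auto simp: oriented_hypergraph_def incidence_def verts_of_def)

text \<open>Double counting of the pairs of a vertex in \<open>S\<close> and a hyperedge containing
  it.\<close>

lemma vol_incidence:
  assumes "oriented_hypergraph V H"
  shows "real (vol H S) = (\<Sum>h\<in>H. \<Sum>i\<in>S. (incidence h i)\<^sup>2)"
proof -
  have "real (hdeg H i) = (\<Sum>h\<in>H. (incidence h i)\<^sup>2)" for i
    using finite_hyperedges[OF assms]
    by (simp add: incidence_sqr[OF assms] hdeg_def sum.inter_filter[symmetric])
  then show ?thesis
    by (subst sum.swap) (simp add: vol_def)
qed

lemma e_tilde_incidence:
  assumes "finite S"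
  shows "e_tilde H S = (\<Sum>h\<in>H. (\<Sum>i\<in>S. incidence h i)\<^sup>2)"
  using assms
  by (simp add: e_tilde_def incidence_def sum_subtractf sum.inter_filter[symmetric]
      Int_def conj_commute)

section \<open>Test functions from a proper coloring\<close>

text \<open>Passes from the restricted family, where distinct hyperedges may coincide, back to
  \<open>H\<close>, over which \<open>vol\<close> and \<open>e_tilde\<close> count.\<close>

lemma proper_coloring_restrict_hyperedges:
  assumes "proper_coloring S (restrict_hyperedges H S) k c"
    "i \<in> S" "j \<in> S" "i \<noteq> j" "h \<in> H" "i \<in> verts_of h" "j \<in> verts_of h"
  shows "c i \<noteq> c j"
proof -
  have "\<exists>h'\<in>restrict_hyperedges H S. i \<in> verts_of h' \<and> j \<in> verts_of h'"
    using assms(2-) by (force simp: restrict_hyperedges_def verts_of_def)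
  with assms(1-4) show ?thesis
    by (auto simp: proper_coloring_def)
qed

text \<open>A hyperedge meets a color class in at most one vertex, so at most one summand is nonzero
  and all cross terms vanish.\<close>

lemma color_class_incidence_sqr:
  assumes "proper_coloring S (restrict_hyperedges H S) k c" "finite S" "h \<in> H"
  shows "(\<Sum>i | i \<in> S \<and> c i = l. incidence h i)\<^sup>2 = (\<Sum>i | i \<in> S \<and> c i = l. (incidence h i)\<^sup>2)"
proof -
  let ?T = "{i. i \<in> S \<and> c i = l}"
  have "incidence h i * incidence h j = (if i = j then (incidence h i)\<^sup>2 else 0)"
    if "i \<in> ?T" "j \<in> ?T" for i j
  proof (cases "i = j")
    case False
    with proper_coloring_restrict_hyperedges[OF assms(1), of i j h] that assms(3)
    have "i \<notin> verts_of h \<or> j \<notin> verts_of h" by auto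
    with False show ?thesis
      by (auto simp: incidence_def verts_of_def)
  qed (simp add: power2_eq_square)
  then have "(\<Sum>i\<in>?T. \<Sum>j\<in>?T. incidence h i * incidence h j)
      = (\<Sum>i\<in>?T. \<Sum>j\<in>?T. if i = j then (incidence h i)\<^sup>2 else 0)"
    by (intro sum.cong refl) auto
  also have "\<dots> = (\<Sum>i\<in>?T. (incidence h i)\<^sup>2)"
    using assms(2) by (intro sum.cong refl) (auto simp: sum.delta')
  finally show ?thesis
    by (simp add: power2_eq_square sum_product)
qed

definition color_test :: "'a set \<Rightarrow> nat \<Rightarrow> ('a \<Rightarrow> nat) \<Rightarrow> nat \<Rightarrow> 'a \<Rightarrow> real" where
  "color_test S k c l i = (if i \<in> S then 1 - real k * (if c i = l then 1 else 0) else 0)"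

text \<open>A vertex of \<open>S\<close> has the value \<open>1 - k\<close> for its own color and 1
  for the other \<open>k - 1\<close>, which contributes
  \<open>(k - 1)^2 + (k - 1) = k^2 - k\<close>.\<close>

lemma sum_color_test_sqnorm:
  assumes "finite V" "S \<subseteq> V" "c ` S \<subseteq> {1..k}"
  shows "(\<Sum>l=1..k. weighted_sqnorm V (\<lambda>i. real (hdeg H i)) (color_test S k c l))
    = (real k ^ 2 - real k) * real (vol H S)"
proof -
  have "(\<Sum>l=1..k. (color_test S k c l i)\<^sup>2) = (if i \<in> S then real k ^ 2 - real k else 0)" for i
  proof (cases "i \<in> S")
    case True
    with assms(3) have ci: "c i \<in> {1..k}" by auto
    have "(\<Sum>l=1..k. (color_test S k c l i)\<^sup>2)
        = (\<Sum>l=1..k. 1 + (if c i = l then real k ^ 2 - 2 * real k else 0))"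
      using True by (intro sum.cong refl) (simp add: color_test_def power2_diff)
    also have "\<dots> = real k ^ 2 - real k"
      using ci unfolding sum.distrib by simp
    finally show ?thesis using True by simp
  qed (simp add: color_test_def)
  then have "(\<Sum>l=1..k. weighted_sqnorm V (\<lambda>i. real (hdeg H i)) (color_test S k c l))
      = (\<Sum>i\<in>V. if i \<in> S then real (hdeg H i) * (real k ^ 2 - real k) else 0)"
    unfolding weighted_sqnorm_def
    by (subst sum.swap) (auto simp: sum_distrib_left[symmetric] intro!: sum.cong)
  also have "\<dots> = (\<Sum>i\<in>S. real (hdeg H i) * (real k ^ 2 - real k))"
    using assms(1,2) by (simp add: sum.inter_restrict[symmetric] Int_absorb1)
  finally show ?thesis
    by (simp add: vol_def sum_distrib_right[symmetric] mult.commute)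
qed

lemma sum_color_test_energy:
  assumes "oriented_hypergraph V H" "S \<subseteq> V"
    "proper_coloring S (restrict_hyperedges H S) k c"
  shows "(\<Sum>l=1..k. \<Sum>h\<in>H. (hyperedge_diff (color_test S k c l) h)\<^sup>2)
    = real k ^ 2 * real (vol H S) - real k * e_tilde H S"
proof -
  have V: "finite V" and S: "finite S"
    using assms(1,2) finite_subset by (auto simp: oriented_hypergraph_def)
  have c: "c ` S \<subseteq> {1..k}"
    using assms(3) by (simp add: proper_coloring_def)
  have "(\<Sum>l=1..k. (hyperedge_diff (color_test S k c l) h)\<^sup>2)
      = real k ^ 2 * (\<Sum>i\<in>S. (incidence h i)\<^sup>2) - real k * (\<Sum>i\<in>S. incidence h i)\<^sup>2"
    if h: "h \<in> H" for h
  proof -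
    \<comment> \<open>With signed total \<open>X\<close> and class sums \<open>x l\<close>, the
      hyperedge difference is \<open>X - k * x l\<close>. Expanding the squares needs only the sums
      over \<open>l\<close> of \<open>x l\<close> and of its square.\<close>
    define X where "X = (\<Sum>i\<in>S. incidence h i)"
    define x where "x l = (\<Sum>i | i \<in> S \<and> c i = l. incidence h i)" for l
    have diff: "hyperedge_diff (color_test S k c l) h = X - real k * x l" for l
    proof -
      have "hyperedge_diff (color_test S k c l) h
          = (\<Sum>i\<in>V. if i \<in> S then incidence h i - real k * (if c i = l then incidence h i else 0) else 0)"
        unfolding hyperedge_diff_incidence[OF assms(1) h]
        by (intro sum.cong refl) (simp add: color_test_def algebra_simps)
      also have "\<dots> = (\<Sum>i\<in>S. incidence h i - real k * (if c i = l then incidence h i else 0))"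
        using V assms(2) by (simp add: sum.inter_restrict[symmetric] Int_absorb1)
      also have "\<dots> = X - real k * x l"
        using S by (simp add: X_def x_def sum_subtractf sum_distrib_left[symmetric] sum.inter_filter)
      finally show ?thesis .
    qed
    have sum_x: "(\<Sum>l=1..k. x l) = X"
      unfolding x_def X_def using S c by (intro sum.group) auto
    \<comment> \<open>Properness of the coloring turns the squared class sums into sums of squares;
      the classes partition \<open>S\<close>.\<close>
    have "(\<Sum>l=1..k. (x l)\<^sup>2) = (\<Sum>l=1..k. \<Sum>i | i \<in> S \<and> c i = l. (incidence h i)\<^sup>2)"
      unfolding x_def by (intro sum.cong refl color_class_incidence_sqr[OF assms(3) S h])
    also have "\<dots> = (\<Sum>i\<in>S. (incidence h i)\<^sup>2)"
      using S c by (intro sum.group) auto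
    finally have sum_x2: "(\<Sum>l=1..k. (x l)\<^sup>2) = (\<Sum>i\<in>S. (incidence h i)\<^sup>2)" .
    have "(\<Sum>l=1..k. (X - real k * x l)\<^sup>2)
        = (\<Sum>l=1..k. X\<^sup>2 - 2 * real k * X * x l + real k ^ 2 * (x l)\<^sup>2)"
      by (intro sum.cong refl) (simp add: power2_diff power_mult_distrib)
    also have "\<dots> = real k * X\<^sup>2 - 2 * real k * X * (\<Sum>l=1..k. x l) + real k ^ 2 * (\<Sum>l=1..k. (x l)\<^sup>2)"
      by (simp only: sum.distrib sum_subtractf sum_distrib_left[symmetric]) simp
    also have "\<dots> = real k ^ 2 * (\<Sum>i\<in>S. (incidence h i)\<^sup>2) - real k * X\<^sup>2"
      unfolding sum_x sum_x2 by (simp add: power2_eq_square)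
    finally show ?thesis
      unfolding diff X_def .
  qed
  then show ?thesis
    by (subst sum.swap)
      (simp add: vol_incidence[OF assms(1)] e_tilde_incidence[OF S] sum_subtractf sum_distrib_left)
qed

text \<open>\<open>b\<close> is the total energy of the test functions divided by their total square
  norm \<open>N\<close>. The number \<open>k\<close> is left free so that a coloring of
  \<open>V\<close> can be used on a smaller \<open>S\<close>.\<close>

lemma proper_coloring_eigenvalue_bounds:
  assumes "oriented_hypergraph V H" "\<forall>i\<in>V. hdeg H i \<noteq> 0" "S \<noteq> {}" "S \<subseteq> V" "k \<ge> 2"
    "proper_coloring S (restrict_hyperedges H S) k c"
  defines "b \<equiv> 1 + (1 - e_tilde H S / real (vol H S)) * (1 / (real k - 1))"
  shows "lambda_min V H \<le> b" "b \<le> lambda_max V H"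
proof -
  define N where "N = (real k ^ 2 - real k) * real (vol H S)"
  have V: "finite V" "V \<noteq> {}" and S: "finite S"
    using assms(1,3,4) finite_subset by (auto simp: oriented_hypergraph_def)
  have vol: "real (vol H S) > 0"
    unfolding vol_def of_nat_sum using S assms(2-4) by (intro sum_pos) (auto simp: subset_iff)
  have k: "real k > 1" using assms(5) by simp
  then have N: "N > 0"
    using vol by (simp add: N_def power2_eq_square)
  have "b * N = real k ^ 2 * real (vol H S) - real k * e_tilde H S"
    using vol k by (simp add: b_def N_def field_simps power2_eq_square)
  then have energy: "(\<Sum>l=1..k. \<Sum>h\<in>H. (hyperedge_diff (color_test S k c l) h)\<^sup>2) = b * N"
    unfolding sum_color_test_energy[OF assms(1,4,6)] by simp
  have norm: "(\<Sum>l=1..k. weighted_sqnorm V (\<lambda>i. real (hdeg H i)) (color_test S k c l)) = N"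
    unfolding N_def
    by (rule sum_color_test_sqnorm) (use V assms(4,6) in \<open>auto simp: proper_coloring_def\<close>)
  \<comment> \<open>The Rayleigh bound holds for each color, so adding over all colors makes it
    unnecessary to single out a good one.\<close>
  have "lambda_min V H * N \<le> b * N"
    unfolding energy[symmetric] unfolding norm[symmetric] sum_distrib_left
    by (intro sum_mono laplacian_rayleigh_bounds assms V)
  then show "lambda_min V H \<le> b" using N by simp
  have "b * N \<le> lambda_max V H * N"
    unfolding energy[symmetric] unfolding norm[symmetric] sum_distrib_left
    by (intro sum_mono laplacian_rayleigh_bounds assms V)
  then show "b \<le> lambda_max V H" using N by simp
qed

section \<open>Optimal colorings and the final estimates\<close>

text \<open>An injective coloring with \<open>card V\<close> colors exists, so the least number of
  colors is attained.\<close>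

lemma ex_coloring_number_coloring:
  assumes "finite V"
  shows "\<exists>c. proper_coloring V H (coloring_number V H) c"
proof -
  obtain c where "bij_betw c V {1..card V}"
    using finite_same_card_bij[of V "{1..card V}"] assms by auto
  then have "proper_coloring V H (card V) c"
    by (auto simp: proper_coloring_def bij_betw_def inj_on_def)
  then have "\<exists>k c. proper_coloring V H k c" by blast
  then show ?thesis
    unfolding coloring_number_def by (rule LeastI_ex)
qed

text \<open>Vertices that share a restricted hyperedge already share the original one.\<close>

lemma proper_coloring_restrict:
  assumes "proper_coloring V H k c" "S \<subseteq> V"
  shows "proper_coloring S (restrict_hyperedges H S) k c"
  unfolding proper_coloring_def
proof (intro conjI ballI impI)
  show "c ` S \<subseteq> {1..k}"
    using assms by (auto simp: proper_coloring_def)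
next
  fix i j
  assume ij: "i \<in> S" "j \<in> S" "i \<noteq> j"
    and "\<exists>h\<in>restrict_hyperedges H S. i \<in> verts_of h \<and> j \<in> verts_of h"
  then have "\<exists>h\<in>H. i \<in> verts_of h \<and> j \<in> verts_of h"
    by (auto simp: restrict_hyperedges_def verts_of_def)
  moreover have "i \<in> V" "j \<in> V" using ij assms(2) by auto
  ultimately show "c i \<noteq> c j"
    using assms(1) ij(3) unfolding proper_coloring_def by metis
qed

theorem theorem4:
  fixes V :: "'a set" and H :: "('a set \<times> 'a set) set"
  assumes "oriented_hypergraph V H"
    and "\<forall>i\<in>V. hdeg H i \<noteq> 0"
  shows "(\<forall>S. S \<noteq> {} \<and> S \<subseteq> V \<and> sub_coloring_number H S \<ge> 2 \<longrightarrow>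
            lambda_max V H \<ge>
              1 + (1 - e_tilde H S / real (vol H S)) * (1 / (real (sub_coloring_number H S) - 1))
          \<and> 1 + (1 - e_tilde H S / real (vol H S)) * (1 / (real (sub_coloring_number H S) - 1))
              \<ge> lambda_min V H)
       \<and> (\<forall>\<chi>. \<chi> = coloring_number V H \<and> \<chi> \<ge> 2 \<longrightarrow>
            lambda_max V H \<ge>
              real \<chi> / (real \<chi> - 1) - e_tilde H V / real (vol H V) * (1 / (real \<chi> - 1))
          \<and> real \<chi> / (real \<chi> - 1) - e_tilde H V / real (vol H V) * (1 / (real \<chi> - 1))
              \<ge> lambda_min V H
          \<and> lambda_max V H \<ge> (real \<chi> - h_tilde' V H) / (real \<chi> - 1))"
proof -
  note bounds = proper_coloring_eigenvalue_bounds[OF assms]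
  have V: "finite V"
    using assms(1) by (simp add: oriented_hypergraph_def)
  have part1: "lambda_max V H \<ge>
        1 + (1 - e_tilde H S / real (vol H S)) * (1 / (real (sub_coloring_number H S) - 1))
      \<and> 1 + (1 - e_tilde H S / real (vol H S)) * (1 / (real (sub_coloring_number H S) - 1))
        \<ge> lambda_min V H"
    if S: "S \<noteq> {}" "S \<subseteq> V" "sub_coloring_number H S \<ge> 2" for S
  proof -
    obtain c where "proper_coloring S (restrict_hyperedges H S) (sub_coloring_number H S) c"
      unfolding sub_coloring_number_def
      using ex_coloring_number_coloring finite_subset[OF S(2) V] by blast
    from bounds[OF S this] show ?thesis by blast
  qed
  have part2: "lambda_max V H \<ge>
        real k / (real k - 1) - e_tilde H V / real (vol H V) * (1 / (real k - 1))
      \<and> real k / (real k - 1) - e_tilde H V / real (vol H V) * (1 / (real k - 1)) \<ge> lambda_min V H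
      \<and> lambda_max V H \<ge> (real k - h_tilde' V H) / (real k - 1)"
    if k: "k = coloring_number V H" "k \<ge> 2" for k
  proof -
    \<comment> \<open>Both displayed forms of the bound equal \<open>(k - r) / (k - 1)\<close>,
      where \<open>r\<close> is the quotient of \<open>e_tilde\<close> and \<open>vol\<close>; the
      three claims become instances of one estimate.\<close>
    have eq1: "1 + (1 - r) * (1 / (real k - 1)) = (real k - r) / (real k - 1)" for r
      using k(2) by (simp add: field_simps)
    have eq2: "real k / (real k - 1) - r * (1 / (real k - 1)) = (real k - r) / (real k - 1)" for r
      by (simp add: diff_divide_distrib)
    obtain c where c: "proper_coloring V H k c"
      using ex_coloring_number_coloring[OF V] k(1) by blast
    have b: "lambda_min V H \<le> (real k - e_tilde H S / real (vol H S)) / (real k - 1)"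
      "(real k - e_tilde H S / real (vol H S)) / (real k - 1) \<le> lambda_max V H"
      if "S \<noteq> {}" "S \<subseteq> V" for S
      using bounds[OF that k(2) proper_coloring_restrict[OF c that(2)]] unfolding eq1 by auto
    \<comment> \<open>An empty \<open>V\<close> would be colorable with 0 colors. Nonemptiness makes
      \<open>V\<close> itself admissible and the set under the minimum nonempty.\<close>
    have "V \<noteq> {}"
    proof
      assume "V = {}"
      then have "proper_coloring V H 0 c" by (simp add: proper_coloring_def)
      then have "coloring_number V H \<le> 0"
        unfolding coloring_number_def by (intro Least_le) blast
      with k show False by simp
    qed
    let ?R = "{e_tilde H S / real (vol H S) | S. S \<noteq> {} \<and> S \<subseteq> V}"
    have "?R = (\<lambda>S. e_tilde H S / real (vol H S)) ` (Pow V - {{}})" by auto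
    with V have "finite ?R" by simp
    moreover have "?R \<noteq> {}" using \<open>V \<noteq> {}\<close> by auto
    \<comment> \<open>The minimum is attained at some \<open>S\<close>, where the bound with
      \<open>k\<close> colors of \<open>V\<close> applies even if \<open>S\<close> has a smaller
      coloring number.\<close>
    ultimately have "h_tilde' V H \<in> ?R"
      unfolding h_tilde'_def by (rule Min_in)
    then obtain S where "h_tilde' V H = e_tilde H S / real (vol H S)" "S \<noteq> {}" "S \<subseteq> V"
      by blast
    with b b[OF \<open>V \<noteq> {}\<close> subset_refl] show ?thesis
      unfolding eq2 by simp
  qed
  show ?thesis
    using part1 part2 by blast
qed

end
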